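(* Let $f$ be a probability density on $[0,\infty)$ with $0<W=\int_0^\infty t f(t)\,dt<\infty$, $f\in C^{(2)}([0,\infty))$ and $\sup_{t\ge 0}|f''(t)|<\infty$. Let $Y_1,Y_2,\dots$ be i.i.d. with density $g(y)=\frac{1}{W}\,y f(y)$, $y\ge 0$, and fix $x>0$ with $f(x)>0$. For positive integers $n,\alpha$ let $$\widehat f^*_\alpha(x)=\frac1n\sum_{i=1}^n \frac{W}{Y_i^2}\cdot\frac{1}{\Gamma(\alpha)}\Big(\frac{\alpha Y_i}{x}\Big)^{\alpha}\exp\Big(-\frac{\alpha}{x}Y_i\Big).$$ Then the bias satisfies $$E\widehat f^*_\alpha(x)-f(x)=\frac{x^2 f''(x)}{2\alpha}+o\Big(\frac1\alpha\Big),\qquad \alpha\to\infty .$$ Moreover, if $\alpha=\alpha(n)$ is chosen with $\alpha(n)\sim n^{2/5}$, then, as $n\to\infty$, $$MSE\{\widehat f^*_\alpha(x)\}=n^{-4/5}\left[\frac{W f(x)}{2\sqrt{\pi}\,x^2}+\frac{x^4\{f''(x)\}^2}{4}\right]+o(n^{-4/5}).$$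
   Context: This is the length-biased sampling model: $f$ is the target density and one observes $Y_1,\dots,Y_n$ from $g$; $W$ is treated as known in the estimator. $MSE\{\widehat f^*_\alpha(x)\}=E\{\widehat f^*_\alpha(x)-f(x)\}^2$. The notation $a_n\sim b_n$ means $a_n/b_n\to1$. *)

theory Defs
  imports "HOL-Probability.Probability" "HOL-Library.Landau_Symbols"
begin

text \<open>The density of the length-biased observations. The indicator is needed because
  \<^term>\<open>f\<close>, a density on the half line, is a total function on the reals in HOL.\<close>

definition length_biased_density :: "(real \<Rightarrow> real) \<Rightarrow> real \<Rightarrow> real \<Rightarrow> real" where
  "length_biased_density f W y = indicator {0..} y * (1 / W * (y * f y))"

text \<open>The sample is \<open>Y 1, \<dots>, Y n\<close>. At \<open>Y i \<omega> = 0\<close>, a null event in the model, the summand is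
  \<open>0\<close> by the convention on division.\<close>

definition gamma_estimator ::
  "real \<Rightarrow> real \<Rightarrow> nat \<Rightarrow> nat \<Rightarrow> (nat \<Rightarrow> 'a \<Rightarrow> real) \<Rightarrow> 'a \<Rightarrow> real" where
  "gamma_estimator W x n \<alpha> Y \<omega> =
     1 / real n * (\<Sum>i=1..n. W / (Y i \<omega>)\<^sup>2 * (1 / Gamma (real \<alpha>))
        * (real \<alpha> * Y i \<omega> / x) ^ \<alpha> * exp (- (real \<alpha> / x) * Y i \<omega>))"

definition MSE :: "'a measure \<Rightarrow> ('a \<Rightarrow> real) \<Rightarrow> real \<Rightarrow> real" where
  "MSE M T \<theta> = (\<integral>\<omega>. (T \<omega> - \<theta>)\<^sup>2 \<partial>M)"

end

theory Submission
  imports Defs "HOL-Real_Asymp.Real_Asymp"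
begin

text \<open>Write \<open>T\<^sub>a\<close> for the summand of the estimator with parameter \<open>a\<close>. Multiplying \<open>T\<^sub>a(y)\<close> by the length-biased
  density \<open>y f(y) / W\<close> cancels \<open>W\<close> and leaves \<open>f(y)\<close> times the Erlang (integer shape Gamma) density of
  shape \<open>a\<close> and rate \<open>a / x\<close>, whose mean is \<open>x\<close> and whose variance is \<open>x\<^sup>2 / a\<close>. So the estimator has
  expectation \<open>E f(G)\<close> with \<open>G\<close> concentrating at \<open>x\<close>. In the second-order Taylor expansion of \<open>f\<close> at \<open>x\<close>
  the linear term has mean zero and the quadratic one contributes exactly \<open>x\<^sup>2 f''(x) / (2 a)\<close>. Near \<open>x\<close>
  the remainder is at most an arbitrarily small multiple of \<open>(t - x)\<^sup>2\<close>, by continuity of \<open>f''\<close>. Far from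
  \<open>x\<close> it is at most a multiple of \<open>(t - x)\<^sup>4\<close>, by boundedness of \<open>f''\<close>. The second central moment is of
  order \<open>1 / a\<close> and the fourth of order \<open>1 / a\<^sup>2\<close>, so the bias has the stated expansion
  (\<open>erlang_bias_asymp\<close>).

  Squaring \<open>T\<^sub>a\<close> before multiplying by the length-biased density again gives an Erlang density, now of
  shape \<open>2 a - 2\<close> and rate \<open>2 a / x\<close>, times \<open>f\<close> and a constant. This Erlang law also concentrates at
  \<open>x\<close>, so \<open>E T\<^sub>a\<^sup>2\<close> is asymptotically \<open>f(x)\<close> times the constant. The constant is essentially
  \<open>W a\<^sup>2 / x\<^sup>2\<close> times a central binomial probability divided by \<open>2 a\<close>, and grows like
  \<open>W \<surd>a / (2 \<surd>\<pi> x\<^sup>2)\<close> (\<open>squared_kernel_constant_asymp\<close>).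

  By independence the mean squared error is \<open>(E T\<^sub>a\<^sup>2 - (E T\<^sub>a)\<^sup>2) / n\<close> plus the squared bias
  (\<open>mean_square_error_of_sample_mean\<close>). The two parts have orders \<open>\<surd>a / n\<close> and \<open>1 / a\<^sup>2\<close>, and
  \<open>a \<sim> n\<^bsup>2/5\<^esup>\<close> makes both of them \<open>n\<^bsup>-4/5\<^esup>\<close> (\<open>mse_rate_balance\<close>).\<close>

section \<open>Integrals against Erlang densities\<close>

lemma has_bochner_integral_erlang_moment:
  assumes "0 < l"
  shows "has_bochner_integral lborel (\<lambda>t. erlang_density k l t * t ^ i)
           (fact (k + i) / (fact k * l ^ i))"
proof (rule has_bochner_integral_nn_integral)
  show "AE t in lborel. 0 \<le> erlang_density k l t * t ^ i"
    using assms by (auto simp: erlang_density_def)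
  show "(\<integral>\<^sup>+ t. ennreal (erlang_density k l t * t ^ i) \<partial>lborel) =
      ennreal (fact (k + i) / (fact k * l ^ i))"
    by (rule nn_integral_erlang_ith_moment[OF assms])
qed (use assms in auto)

lemma has_bochner_integral_erlang_one:
  assumes "0 < l"
  shows "has_bochner_integral lborel (erlang_density k l) 1"
  using has_bochner_integral_erlang_moment[OF assms, of k 0] by simp

text \<open>The density with index \<open>k\<close> has shape \<open>k + 1\<close>. The centre \<open>c\<close> is arbitrary because the law that
  governs the second moment of the estimator has a mean that only tends to the point of estimation.\<close>

lemma has_bochner_integral_erlang_first_deviation:
  assumes "0 < l"
  shows "has_bochner_integral lborel (\<lambda>t. erlang_density k l t * (t - c)) ((real k + 1) / l - c)"
proof -
  have "has_bochner_integral lborel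
     (\<lambda>t. erlang_density k l t * t ^ 1 - c * erlang_density k l t)
     (fact (k + 1) / (fact k * l ^ 1) - c * 1)"
    by (intro has_bochner_integral_diff has_bochner_integral_mult_right
        has_bochner_integral_erlang_moment has_bochner_integral_erlang_one assms)
  moreover have "fact (k + 1) / (fact k * l ^ 1) - c * 1 = (real k + 1) / l - c"
    using assms by (simp add: field_simps)
  moreover have "erlang_density k l t * t ^ 1 - c * erlang_density k l t
      = erlang_density k l t * (t - c)" for t
    by (simp add: algebra_simps)
  ultimately show ?thesis by (simp only:)
qed

lemma has_bochner_integral_erlang_second_deviation:
  assumes "0 < l"
  shows "has_bochner_integral lborel (\<lambda>t. erlang_density k l t * (t - c)\<^sup>2)
     ((real k + 1) / l\<^sup>2 + ((real k + 1) / l - c)\<^sup>2)"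
proof -
  have "has_bochner_integral lborel
     (\<lambda>t. erlang_density k l t * t ^ 2 - 2 * c * (erlang_density k l t * t ^ 1)
          + c\<^sup>2 * erlang_density k l t)
     (fact (k + 2) / (fact k * l ^ 2) - 2 * c * (fact (k + 1) / (fact k * l ^ 1)) + c\<^sup>2 * 1)"
    by (intro has_bochner_integral_diff has_bochner_integral_add has_bochner_integral_mult_right
        has_bochner_integral_erlang_moment has_bochner_integral_erlang_one assms)
  moreover have "fact (k + 2) / (fact k * l ^ 2) - 2 * c * (fact (k + 1) / (fact k * l ^ 1)) + c\<^sup>2 * 1
     = (real k + 1) / l\<^sup>2 + ((real k + 1) / l - c)\<^sup>2"
    using assms by (simp add: field_simps power2_eq_square)
  moreover have "erlang_density k l t * t ^ 2 - 2 * c * (erlang_density k l t * t ^ 1)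
          + c\<^sup>2 * erlang_density k l t = erlang_density k l t * (t - c)\<^sup>2" for t
    by (simp add: algebra_simps power2_eq_square)
  ultimately show ?thesis by simp
qed

text \<open>The leading terms of the expansion of \<open>(t - x)\<^sup>4\<close> cancel down to order \<open>1 / (k + 1)\<^sup>2\<close>. This decay is what
  makes the tail part of the Taylor remainder negligible against the bias.\<close>

lemma has_bochner_integral_erlang_fourth_central_moment:
  assumes "0 < x"
  shows "has_bochner_integral lborel
     (\<lambda>t. erlang_density k ((real k + 1) / x) t * (t - x) ^ 4)
     (x ^ 4 * (3 / (real k + 1)\<^sup>2 + 6 / (real k + 1) ^ 3))"
proof -
  define a where "a = real k + 1"
  define l where "l = a / x"
  have a: "a > 0" and l: "l > 0" using assms by (auto simp: a_def l_def)
  have fa: "fact (k + 1) = fact k * a" "fact (k + 2) = fact k * (a * (a + 1))"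
    "fact (k + 3) = fact k * (a * (a + 1) * (a + 2))"
    "fact (k + 4) = fact k * (a * (a + 1) * (a + 2) * (a + 3))"
    by (simp_all add: a_def numeral_eq_Suc algebra_simps)
  have *: "has_bochner_integral lborel
     (\<lambda>t. erlang_density k l t * t ^ 4 - 4 * x * (erlang_density k l t * t ^ 3)
          + 6 * x\<^sup>2 * (erlang_density k l t * t ^ 2) - 4 * x ^ 3 * (erlang_density k l t * t ^ 1)
          + x ^ 4 * erlang_density k l t)
     (fact (k + 4) / (fact k * l ^ 4) - 4 * x * (fact (k + 3) / (fact k * l ^ 3))
      + 6 * x\<^sup>2 * (fact (k + 2) / (fact k * l ^ 2)) - 4 * x ^ 3 * (fact (k + 1) / (fact k * l ^ 1))
      + x ^ 4 * 1)"
    by (intro has_bochner_integral_diff has_bochner_integral_add has_bochner_integral_mult_right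
        has_bochner_integral_erlang_moment has_bochner_integral_erlang_one l)
  have quot: "fact (k + 1) / (fact k * l ^ 1) = x"
    "fact (k + 2) / (fact k * l ^ 2) = x\<^sup>2 * (1 + 1 / a)"
    "fact (k + 3) / (fact k * l ^ 3) = x ^ 3 * ((1 + 1 / a) * (1 + 2 / a))"
    "fact (k + 4) / (fact k * l ^ 4) = x ^ 4 * ((1 + 1 / a) * (1 + 2 / a) * (1 + 3 / a))"
    unfolding fa l_def using a assms
    by (simp_all add: divide_simps) (simp_all add: power2_eq_square power3_eq_cube power4_eq_xxxx)
  have "fact (k + 4) / (fact k * l ^ 4) - 4 * x * (fact (k + 3) / (fact k * l ^ 3))
      + 6 * x\<^sup>2 * (fact (k + 2) / (fact k * l ^ 2)) - 4 * x ^ 3 * (fact (k + 1) / (fact k * l ^ 1))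
      + x ^ 4 * 1 = x ^ 4 * (3 * (1 / a)\<^sup>2 + 6 * (1 / a) ^ 3)"
  proof -
    have "2 / a = 2 * (1 / a)" "3 / a = 3 * (1 / a)" by simp_all
    then show ?thesis unfolding quot
      by algebra
  qed
  also have "\<dots> = x ^ 4 * (3 / a\<^sup>2 + 6 / a ^ 3)"
    by (simp add: power_divide)
  finally have "fact (k + 4) / (fact k * l ^ 4) - 4 * x * (fact (k + 3) / (fact k * l ^ 3))
      + 6 * x\<^sup>2 * (fact (k + 2) / (fact k * l ^ 2)) - 4 * x ^ 3 * (fact (k + 1) / (fact k * l ^ 1))
      + x ^ 4 * 1 = x ^ 4 * (3 / a\<^sup>2 + 6 / a ^ 3)" .
  moreover have "erlang_density k l t * t ^ 4 - 4 * x * (erlang_density k l t * t ^ 3)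
          + 6 * x\<^sup>2 * (erlang_density k l t * t ^ 2) - 4 * x ^ 3 * (erlang_density k l t * t ^ 1)
          + x ^ 4 * erlang_density k l t = erlang_density k l t * (t - x) ^ 4" for t
    by (simp add: algebra_simps power2_eq_square power3_eq_cube power4_eq_xxxx)
  ultimately show ?thesis using * by (simp add: l_def a_def)
qed

text \<open>The Erlang density vanishes on the negative half line, so \<open>h\<close> has to be regular only on \<open>{0..}\<close>,
  although the integral runs over all reals.\<close>

lemma integrable_erlang_of_bound:
  assumes l: "0 < l" and h: "continuous_on {0..} h"
    and bound: "\<And>t. 0 \<le> t \<Longrightarrow> \<bar>h t\<bar> \<le> u t"
    and u: "integrable lborel (\<lambda>t. erlang_density k l t * u t)"
  shows "integrable lborel (\<lambda>t. erlang_density k l t * h t)"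
proof (rule Bochner_Integration.integrable_bound[OF u])
  have "(\<lambda>t. indicator {0..} t *\<^sub>R h t) \<in> borel_measurable borel"
    by (rule borel_measurable_continuous_on_indicator[OF _ h]) auto
  then have "(\<lambda>t. erlang_density k l t * (indicator {0..} t *\<^sub>R h t)) \<in> borel_measurable lborel"
    by simp
  moreover have "(\<lambda>t. erlang_density k l t * (indicator {0..} t *\<^sub>R h t))
      = (\<lambda>t. erlang_density k l t * h t)"
    by (auto simp: erlang_density_def indicator_def)
  ultimately show "(\<lambda>t. erlang_density k l t * h t) \<in> borel_measurable lborel" by simp
  have "norm (erlang_density k l t * h t) \<le> norm (erlang_density k l t * u t)" for t
  proof (cases "0 \<le> t")
    case True
    have "\<bar>h t\<bar> \<le> \<bar>u t\<bar>" using bound[OF True] by simp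
    then show ?thesis by (simp add: abs_mult mult_left_mono)
  qed (simp add: erlang_density_def)
  then show "AE t in lborel. norm (erlang_density k l t * h t) \<le> norm (erlang_density k l t * u t)"
    by simp
qed

lemma erlang_integral_abs_le:
  assumes l: "0 < l" and h: "continuous_on {0..} h"
    and bound: "\<And>t. 0 \<le> t \<Longrightarrow> \<bar>h t\<bar> \<le> u t"
    and u: "has_bochner_integral lborel (\<lambda>t. erlang_density k l t * u t) v"
  shows "\<bar>\<integral>t. erlang_density k l t * h t \<partial>lborel\<bar> \<le> v"
proof -
  note ui = has_bochner_integral_iff[THEN iffD1, OF u]
  have "integrable lborel (\<lambda>t. erlang_density k l t * h t)"
    using integrable_erlang_of_bound[OF l h bound] ui by blast
  then have "\<bar>\<integral>t. erlang_density k l t * h t \<partial>lborel\<bar> \<le> (\<integral>t. erlang_density k l t * u t \<partial>lborel)"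
  proof (intro integral_abs_bound[THEN order_trans] integral_mono integrable_abs)
    fix t
    show "\<bar>erlang_density k l t * h t\<bar> \<le> erlang_density k l t * u t"
    proof (cases "0 \<le> t")
      case True
      then show ?thesis using bound[OF True] l by (simp add: abs_mult mult_left_mono)
    qed (simp add: erlang_density_def)
  qed (use ui in auto)
  then show ?thesis using ui by simp
qed

section \<open>Erlang means of a function with bounded second derivative\<close>

text \<open>Allowing an arbitrary constant \<open>c\<close> as quadratic coefficient covers the expansion to first order
  (\<open>c = 0\<close>, with \<open>B\<close> a global bound on \<open>f''\<close>) and the expansion to second order (\<open>c = f''(x)\<close>, with \<open>B\<close> the
  oscillation of \<open>f''\<close> on \<open>S\<close>).\<close>

lemma taylor_order_two_bound:
  fixes f f' f'' :: "real \<Rightarrow> real"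
  assumes S: "convex S"
    and d1: "\<And>t. t \<in> S \<Longrightarrow> (f has_real_derivative f' t) (at t within S)"
    and d2: "\<And>t. t \<in> S \<Longrightarrow> (f' has_real_derivative f'' t) (at t within S)"
    and B: "\<And>t. t \<in> S \<Longrightarrow> \<bar>f'' t - c\<bar> \<le> B"
    and x: "x \<in> S" and t: "t \<in> S"
  shows "\<bar>f t - f x - f' x * (t - x) - c / 2 * (t - x)\<^sup>2\<bar> \<le> B * (t - x)\<^sup>2"
proof -
  define g where "g i = (if i = 0 then \<lambda>t. f t - c / 2 * (t - x)\<^sup>2
    else if i = 1 then \<lambda>t. f' t - c * (t - x) else (\<lambda>t. f'' t - c))" for i :: nat
  have d: "(g i has_field_derivative g (Suc i) s) (at s within S)" if "s \<in> S" "i \<le> 1" for i s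
  proof (cases "i = 0")
    case True
    then show ?thesis unfolding g_def using d1[OF that(1)]
      by (auto intro!: derivative_eq_intros)
  next
    case False
    with that have "i = 1" by simp
    then show ?thesis unfolding g_def using d2[OF that(1)]
      by (auto intro!: derivative_eq_intros)
  qed
  have "norm (g 0 t - (\<Sum>i\<le>1. g i x * (t - x) ^ i / fact i)) \<le> B * norm (t - x) ^ Suc 1 / fact 1"
    by (rule field_Taylor[where S = S and f = g, OF S]) (use d B x t in \<open>auto simp: g_def\<close>)
  then show ?thesis by (simp add: g_def algebra_simps numeral_2_eq_2)
qed

locale bounded_second_derivative =
  fixes f f' f'' :: "real \<Rightarrow> real" and K :: real
  assumes deriv1: "\<And>t. t \<ge> 0 \<Longrightarrow> (f has_real_derivative f' t) (at t within {0..})"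
    and deriv2: "\<And>t. t \<ge> 0 \<Longrightarrow> (f' has_real_derivative f'' t) (at t within {0..})"
    and bound: "\<And>t. t \<ge> 0 \<Longrightarrow> \<bar>f'' t\<bar> \<le> K"
begin

lemma continuous_on_f: "continuous_on {0..} f"
  by (rule DERIV_continuous_on) (use deriv1 in auto)

lemma second_order_remainder_le:
  assumes "0 \<le> x" "0 \<le> t"
  shows "\<bar>f t - f x - f' x * (t - x)\<bar> \<le> K * (t - x)\<^sup>2"
  using taylor_order_two_bound[of "{0..}" f f' f'' 0 K x t] deriv1 deriv2 bound assms
  by simp

lemma integrable_erlang:
  assumes "0 < l"
  shows "integrable lborel (\<lambda>t. erlang_density k l t * f t)"
proof (rule integrable_erlang_of_bound[OF assms continuous_on_f])
  show "\<bar>f t\<bar> \<le> \<bar>f 0\<bar> + \<bar>f' 0\<bar> * t ^ 1 + K * t ^ 2" if "0 \<le> t" for t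
  proof -
    have "\<bar>f t\<bar> \<le> \<bar>f t - f 0 - f' 0 * (t - 0)\<bar> + \<bar>f 0\<bar> + \<bar>f' 0 * t\<bar>" by simp
    also have "\<bar>f' 0 * t\<bar> = \<bar>f' 0\<bar> * t" using that by (simp add: abs_mult)
    finally show ?thesis using second_order_remainder_le[of 0 t] that by simp
  qed
  have "integrable lborel (\<lambda>t. \<bar>f 0\<bar> * (erlang_density k l t * t ^ 0)
      + \<bar>f' 0\<bar> * (erlang_density k l t * t ^ 1) + K * (erlang_density k l t * t ^ 2))"
    by (intro Bochner_Integration.integrable_add integrable_mult_right
        integrable.intros[OF has_bochner_integral_erlang_moment[OF assms]])
  then show "integrable lborel
      (\<lambda>t. erlang_density k l t * (\<bar>f 0\<bar> + \<bar>f' 0\<bar> * t ^ 1 + K * t ^ 2))"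
    by (simp add: algebra_simps)
qed

text \<open>The Erlang mean of a Taylor remainder is the error of the corresponding moment expansion of the
  Erlang mean of \<open>f\<close>. A pointwise bound on the remainder therefore bounds that error.\<close>

lemma erlang_integral_taylor_remainder:
  assumes "0 < l"
  shows "(\<integral>t. erlang_density k l t * (f t - f x - f' x * (t - x) - c / 2 * (t - x)\<^sup>2) \<partial>lborel)
    = (\<integral>t. erlang_density k l t * f t \<partial>lborel) - f x - f' x * ((real k + 1) / l - x)
      - c / 2 * ((real k + 1) / l\<^sup>2 + ((real k + 1) / l - x)\<^sup>2)"
proof -
  have "has_bochner_integral lborel
      (\<lambda>t. erlang_density k l t * f t - f x * erlang_density k l t
        - f' x * (erlang_density k l t * (t - x)) - c / 2 * (erlang_density k l t * (t - x)\<^sup>2))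
      ((\<integral>t. erlang_density k l t * f t \<partial>lborel) - f x * 1 - f' x * ((real k + 1) / l - x)
      - c / 2 * ((real k + 1) / l\<^sup>2 + ((real k + 1) / l - x)\<^sup>2))"
    by (intro has_bochner_integral_diff has_bochner_integral_mult_right
        has_bochner_integral_erlang_one has_bochner_integral_erlang_first_deviation
        has_bochner_integral_erlang_second_deviation has_bochner_integral_integrable
        integrable_erlang assms)
  moreover have "erlang_density k l t * f t - f x * erlang_density k l t
        - f' x * (erlang_density k l t * (t - x)) - c / 2 * (erlang_density k l t * (t - x)\<^sup>2)
      = erlang_density k l t * (f t - f x - f' x * (t - x) - c / 2 * (t - x)\<^sup>2)" for t
    by (simp add: algebra_simps)
  ultimately show ?thesis by (simp add: has_bochner_integral_iff)
qed

text \<open>The two hypotheses say that the mean tends to \<open>x\<close> and the variance to zero. Since the first-order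
  remainder is at most \<open>K (t - x)\<^sup>2\<close>, its Erlang mean is at most \<open>K\<close> times the sum of the variance and the
  squared offset of the mean.\<close>

lemma erlang_mean_tendsto:
  assumes x: "0 \<le> x" and l: "\<And>n. 0 < l n"
    and mean: "(\<lambda>n. (real (k n) + 1) / l n) \<longlonglongrightarrow> x"
    and var: "(\<lambda>n. (real (k n) + 1) / (l n)\<^sup>2) \<longlonglongrightarrow> 0"
  shows "(\<lambda>n. \<integral>t. erlang_density (k n) (l n) t * f t \<partial>lborel) \<longlonglongrightarrow> f x"
proof -
  define m where "m = (\<lambda>n. (real (k n) + 1) / l n)"
  define v where "v = (\<lambda>n. (real (k n) + 1) / (l n)\<^sup>2)"
  have m: "m \<longlonglongrightarrow> x" and v: "v \<longlonglongrightarrow> 0" using mean var by (simp_all add: m_def v_def)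
  have le: "norm ((\<integral>t. erlang_density (k n) (l n) t * f t \<partial>lborel) - f x - f' x * (m n - x))
      \<le> K * (v n + (m n - x)\<^sup>2)" for n
  proof -
    have "\<bar>\<integral>t. erlang_density (k n) (l n) t * (f t - f x - f' x * (t - x) - 0 / 2 * (t - x)\<^sup>2) \<partial>lborel\<bar>
        \<le> K * (v n + (m n - x)\<^sup>2)"
    proof (rule erlang_integral_abs_le[OF l])
      show "continuous_on {0..} (\<lambda>t. f t - f x - f' x * (t - x) - 0 / 2 * (t - x)\<^sup>2)"
        by (intro continuous_intros continuous_on_f) auto
      show "\<bar>f t - f x - f' x * (t - x) - 0 / 2 * (t - x)\<^sup>2\<bar> \<le> K * (t - x)\<^sup>2" if "0 \<le> t" for t
        using second_order_remainder_le[OF x that] by simp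
      have "has_bochner_integral lborel (\<lambda>t. K * (erlang_density (k n) (l n) t * (t - x)\<^sup>2))
          (K * (v n + (m n - x)\<^sup>2))"
        unfolding v_def m_def
        by (intro has_bochner_integral_mult_right has_bochner_integral_erlang_second_deviation l)
      then show "has_bochner_integral lborel (\<lambda>t. erlang_density (k n) (l n) t * (K * (t - x)\<^sup>2))
          (K * (v n + (m n - x)\<^sup>2))"
        by (simp add: mult.left_commute)
    qed
    then show ?thesis
      unfolding erlang_integral_taylor_remainder[OF l] by (simp add: m_def)
  qed
  have "(\<lambda>n. K * (v n + (m n - x)\<^sup>2)) \<longlonglongrightarrow> K * (0 + (x - x)\<^sup>2)"
    by (intro tendsto_intros m v)
  then have lim: "(\<lambda>n. K * (v n + (m n - x)\<^sup>2)) \<longlonglongrightarrow> 0" by simp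
  have "(\<lambda>n. (\<integral>t. erlang_density (k n) (l n) t * f t \<partial>lborel) - f x - f' x * (m n - x)) \<longlonglongrightarrow> 0"
    by (rule Lim_null_comparison[OF always_eventually lim]) (rule allI, rule le)
  moreover have "(\<lambda>n. f x + f' x * (m n - x)) \<longlonglongrightarrow> f x + f' x * (x - x)"
    by (intro tendsto_intros m)
  ultimately have "(\<lambda>n. ((\<integral>t. erlang_density (k n) (l n) t * f t \<partial>lborel) - f x - f' x * (m n - x))
      + (f x + f' x * (m n - x))) \<longlonglongrightarrow> 0 + (f x + f' x * (x - x))"
    by (rule tendsto_add)
  then show ?thesis by simp
qed

text \<open>Within distance \<open>\<delta>\<close> of \<open>x\<close> continuity of \<open>f''\<close> gives the first term. Beyond that distance
  \<open>1 \<le> (t - x)\<^sup>2 / \<delta>\<^sup>2\<close>, so the crude bound \<open>2 K (t - x)\<^sup>2\<close> is absorbed by the quartic term.\<close>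

lemma local_taylor_remainder_le:
  assumes cont: "continuous_on {0..} f''" and x: "0 \<le> x" and \<eta>: "0 < \<eta>"
  obtains C where "\<And>t. 0 \<le> t \<Longrightarrow>
    \<bar>f t - f x - f' x * (t - x) - f'' x / 2 * (t - x)\<^sup>2\<bar> \<le> \<eta> * (t - x)\<^sup>2 + C * (t - x) ^ 4"
proof -
  obtain \<delta> where \<delta>: "\<delta> > 0" "\<And>s. 0 \<le> s \<Longrightarrow> \<bar>s - x\<bar> < \<delta> \<Longrightarrow> \<bar>f'' s - f'' x\<bar> < \<eta>"
    using cont x \<eta> unfolding continuous_on_iff dist_real_def by (metis atLeast_iff)
  have K: "0 \<le> K" using bound[OF x] by simp
  have "\<bar>f t - f x - f' x * (t - x) - f'' x / 2 * (t - x)\<^sup>2\<bar>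
      \<le> \<eta> * (t - x)\<^sup>2 + (2 * K / \<delta>\<^sup>2) * (t - x) ^ 4" if t: "0 \<le> t" for t
  proof (cases "\<bar>t - x\<bar> < \<delta>")
    case True
    define S where "S = {0..} \<inter> ball x \<delta>"
    have "\<bar>f t - f x - f' x * (t - x) - f'' x / 2 * (t - x)\<^sup>2\<bar> \<le> \<eta> * (t - x)\<^sup>2"
    proof (rule taylor_order_two_bound[of S f f' f''])
      show "convex S" unfolding S_def by (intro convex_Int convex_ball) auto
      show "(f has_real_derivative f' s) (at s within S)" if "s \<in> S" for s
        using that deriv1 by (auto simp: S_def intro: has_field_derivative_subset)
      show "(f' has_real_derivative f'' s) (at s within S)" if "s \<in> S" for s
        using that deriv2 by (auto simp: S_def intro: has_field_derivative_subset)
      show "\<bar>f'' s - f'' x\<bar> \<le> \<eta>" if "s \<in> S" for s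
        using that \<delta>(2)[of s] by (auto simp: S_def dist_real_def abs_minus_commute)
      show "x \<in> S" "t \<in> S" using x t \<delta> True by (auto simp: S_def dist_real_def abs_minus_commute)
    qed
    also have "\<dots> \<le> \<eta> * (t - x)\<^sup>2 + (2 * K / \<delta>\<^sup>2) * (t - x) ^ 4" using K by simp
    finally show ?thesis .
  next
    case False
    have "\<bar>f t - f x - f' x * (t - x) - f'' x / 2 * (t - x)\<^sup>2\<bar> \<le> (2 * K) * (t - x)\<^sup>2"
    proof (rule taylor_order_two_bound[of "{0..}" f f' f''])
      show "\<bar>f'' s - f'' x\<bar> \<le> 2 * K" if "s \<in> {0..}" for s
        using bound[of s] bound[OF x] that by auto
    qed (use deriv1 deriv2 x t in auto)
    also have "\<dots> = (2 * K / \<delta>\<^sup>2) * (\<delta>\<^sup>2 * (t - x)\<^sup>2)" using \<delta> by simp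
    also have "\<dots> \<le> (2 * K / \<delta>\<^sup>2) * ((t - x)\<^sup>2 * (t - x)\<^sup>2)"
    proof (intro mult_left_mono mult_right_mono)
      show "\<delta>\<^sup>2 \<le> (t - x)\<^sup>2" using False \<delta>(1) by (simp add: abs_le_square_iff[symmetric])
    qed (use K in auto)
    also have "\<dots> = (2 * K / \<delta>\<^sup>2) * (t - x) ^ 4" by (simp add: power2_eq_square power4_eq_xxxx)
    also have "\<dots> \<le> \<eta> * (t - x)\<^sup>2 + (2 * K / \<delta>\<^sup>2) * (t - x) ^ 4" using \<eta> by simp
    finally show ?thesis .
  qed
  then show ?thesis by (rule that)
qed

text \<open>With rate \<open>(k + 1) / x\<close> the mean is exactly \<open>x\<close>, so the linear term drops out. After scaling by the
  shape, the \<open>\<eta>\<close> part of the remainder bound contributes \<open>\<eta> x\<^sup>2\<close>, which is as small as desired, and the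
  quartic part tends to zero.\<close>

lemma erlang_bias_asymp:
  assumes cont: "continuous_on {0..} f''" and x: "0 < x"
  shows "(\<lambda>k. (real k + 1) *
      ((\<integral>t. erlang_density k ((real k + 1) / x) t * f t \<partial>lborel) - f x)) \<longlonglongrightarrow> x\<^sup>2 * f'' x / 2"
proof (rule LIMSEQ_I)
  fix \<epsilon> :: real assume \<epsilon>: "0 < \<epsilon>"
  define \<eta> where "\<eta> = \<epsilon> / (2 * x\<^sup>2)"
  have \<eta>: "0 < \<eta>" "\<eta> * x\<^sup>2 = \<epsilon> / 2" using \<epsilon> x by (auto simp: \<eta>_def)
  obtain C where C: "\<And>t. 0 \<le> t \<Longrightarrow>
      \<bar>f t - f x - f' x * (t - x) - f'' x / 2 * (t - x)\<^sup>2\<bar> \<le> \<eta> * (t - x)\<^sup>2 + C * (t - x) ^ 4"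
    using local_taylor_remainder_le[OF cont less_imp_le[OF x] \<eta>(1)] by blast
  have "(\<lambda>k. C * x ^ 4 * (3 / (real k + 1) + 6 / (real k + 1)\<^sup>2)) \<longlonglongrightarrow> C * x ^ 4 * 0"
    by (rule tendsto_mult[OF tendsto_const]) real_asymp
  then have "\<forall>\<^sub>F k in sequentially. C * x ^ 4 * (3 / (real k + 1) + 6 / (real k + 1)\<^sup>2) < \<epsilon> / 2"
    by (rule order_tendstoD) (use \<epsilon> in simp)
  then obtain k0 where k0: "\<And>k. k \<ge> k0 \<Longrightarrow>
      C * x ^ 4 * (3 / (real k + 1) + 6 / (real k + 1)\<^sup>2) < \<epsilon> / 2"
    by (auto simp: eventually_sequentially)
  have "norm ((real k + 1) * ((\<integral>t. erlang_density k ((real k + 1) / x) t * f t \<partial>lborel) - f x)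
      - x\<^sup>2 * f'' x / 2) < \<epsilon>" if "k \<ge> k0" for k
  proof -
    define a where "a = real k + 1"
    have a: "a > 0" by (simp add: a_def)
    have l: "a / x > 0" using a x by simp
    define I where "I = (\<integral>t. erlang_density k (a / x) t * f t \<partial>lborel)"
    have v: "(real k + 1) / (a / x)\<^sup>2 + ((real k + 1) / (a / x) - x)\<^sup>2 = x\<^sup>2 / a"
      using a x by (simp add: a_def[symmetric] power2_eq_square)
    have "\<bar>\<integral>t. erlang_density k (a / x) t
          * (f t - f x - f' x * (t - x) - f'' x / 2 * (t - x)\<^sup>2) \<partial>lborel\<bar>
        \<le> \<eta> * (x\<^sup>2 / a) + C * (x ^ 4 * (3 / a\<^sup>2 + 6 / a ^ 3))"
    proof (rule erlang_integral_abs_le[OF l _ C])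
      show "continuous_on {0..} (\<lambda>t. f t - f x - f' x * (t - x) - f'' x / 2 * (t - x)\<^sup>2)"
        by (intro continuous_intros continuous_on_f)
      have "has_bochner_integral lborel (\<lambda>t. \<eta> * (erlang_density k (a / x) t * (t - x)\<^sup>2)
            + C * (erlang_density k (a / x) t * (t - x) ^ 4))
          (\<eta> * (x\<^sup>2 / a) + C * (x ^ 4 * (3 / a\<^sup>2 + 6 / a ^ 3)))"
        using has_bochner_integral_erlang_second_deviation[OF l, of k x]
          has_bochner_integral_erlang_fourth_central_moment[OF x, of k]
        unfolding v unfolding a_def[symmetric]
        by (intro has_bochner_integral_add has_bochner_integral_mult_right)
      then show "has_bochner_integral lborel
          (\<lambda>t. erlang_density k (a / x) t * (\<eta> * (t - x)\<^sup>2 + C * (t - x) ^ 4))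
          (\<eta> * (x\<^sup>2 / a) + C * (x ^ 4 * (3 / a\<^sup>2 + 6 / a ^ 3)))"
        by (simp add: algebra_simps)
    qed
    moreover have "(real k + 1) / (a / x) - x = 0" using a x by (simp add: a_def[symmetric])
    ultimately have "\<bar>I - f x - f'' x / 2 * (x\<^sup>2 / a)\<bar>
        \<le> \<eta> * (x\<^sup>2 / a) + C * (x ^ 4 * (3 / a\<^sup>2 + 6 / a ^ 3))"
      unfolding erlang_integral_taylor_remainder[OF l] v I_def by simp
    then have "a * \<bar>I - f x - f'' x / 2 * (x\<^sup>2 / a)\<bar>
        \<le> a * (\<eta> * (x\<^sup>2 / a) + C * (x ^ 4 * (3 / a\<^sup>2 + 6 / a ^ 3)))"
      using a by (intro mult_left_mono) auto
    also have "\<dots> = \<eta> * x\<^sup>2 + C * x ^ 4 * (3 / a + 6 / a\<^sup>2)"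
      using a by (simp add: field_simps power2_eq_square power3_eq_cube)
    also have "\<dots> < \<epsilon>" using k0[OF that] \<eta>(2) unfolding a_def by linarith
    also have "a * \<bar>I - f x - f'' x / 2 * (x\<^sup>2 / a)\<bar> = \<bar>a * (I - f x) - x\<^sup>2 * f'' x / 2\<bar>"
    proof -
      have "a * \<bar>I - f x - f'' x / 2 * (x\<^sup>2 / a)\<bar> = \<bar>a * (I - f x - f'' x / 2 * (x\<^sup>2 / a))\<bar>"
        using a by (simp add: abs_mult)
      also have "a * (I - f x - f'' x / 2 * (x\<^sup>2 / a)) = a * (I - f x) - x\<^sup>2 * f'' x / 2"
        using a by (simp add: field_simps)
      finally show ?thesis .
    qed
    finally show ?thesis by (simp add: I_def a_def)
  qed
  then show "\<exists>k0. \<forall>k\<ge>k0. norm ((real k + 1) *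
      ((\<integral>t. erlang_density k ((real k + 1) / x) t * f t \<partial>lborel) - f x) - x\<^sup>2 * f'' x / 2) < \<epsilon>"
    by blast
qed

end

section \<open>Mean squared error of a sample mean\<close>

text \<open>Expanding the square of the sum gives \<open>n\<close> diagonal terms \<open>s\<close> and \<open>n (n - 1)\<close> off-diagonal
  terms, each equal to \<open>\<mu>\<^sup>2\<close> by independence.\<close>

lemma (in prob_space) mean_square_error_of_sample_mean:
  fixes X :: "'i \<Rightarrow> 'a \<Rightarrow> real"
  assumes I: "finite I" "I \<noteq> {}" and indep: "indep_vars (\<lambda>_. borel) X I"
    and int: "\<And>i. i \<in> I \<Longrightarrow> integrable M (X i)"
    and int2: "\<And>i. i \<in> I \<Longrightarrow> integrable M (\<lambda>\<omega>. (X i \<omega>)\<^sup>2)"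
    and mean: "\<And>i. i \<in> I \<Longrightarrow> expectation (X i) = \<mu>"
    and second: "\<And>i. i \<in> I \<Longrightarrow> expectation (\<lambda>\<omega>. (X i \<omega>)\<^sup>2) = s"
  shows "expectation (\<lambda>\<omega>. (1 / real (card I) * (\<Sum>i\<in>I. X i \<omega>) - \<theta>)\<^sup>2)
    = (s - \<mu>\<^sup>2) / real (card I) + (\<mu> - \<theta>)\<^sup>2"
proof -
  define n where "n = real (card I)"
  have n: "n > 0" using I by (simp add: n_def card_gt_0_iff)
  have prod: "integrable M (\<lambda>\<omega>. X i \<omega> * X j \<omega>) \<and>
      expectation (\<lambda>\<omega>. X i \<omega> * X j \<omega>) = \<mu>\<^sup>2 + (if i = j then s - \<mu>\<^sup>2 else 0)"
    if ij: "i \<in> I" "j \<in> I" for i j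
  proof (cases "i = j")
    case True
    then show ?thesis using int2[OF ij(1)] second[OF ij(1)] by (simp add: power2_eq_square)
  next
    case False
    have sub: "indep_vars (\<lambda>_. borel) X {i, j}"
      using indep_vars_subset[OF indep] ij by auto
    have "integrable M (\<lambda>\<omega>. \<Prod>k\<in>{i, j}. X k \<omega>)"
      by (rule indep_vars_integrable[OF _ sub]) (use int ij in auto)
    moreover have "expectation (\<lambda>\<omega>. \<Prod>k\<in>{i, j}. X k \<omega>) = (\<Prod>k\<in>{i, j}. expectation (X k))"
      by (rule indep_vars_lebesgue_integral[OF _ sub]) (use int ij in auto)
    ultimately show ?thesis using False mean ij by (simp add: power2_eq_square)
  qed
  define S where "S \<omega> = (\<Sum>i\<in>I. X i \<omega>)" for \<omega>
  have S: "integrable M S" unfolding S_def using int by auto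
  have ES: "expectation S = n * \<mu>"
    unfolding S_def using int mean by (subst Bochner_Integration.integral_sum) (auto simp: n_def)
  have S2_eq: "(S \<omega>)\<^sup>2 = (\<Sum>i\<in>I. \<Sum>j\<in>I. X i \<omega> * X j \<omega>)" for \<omega>
    unfolding S_def power2_eq_square sum_product ..
  have S2: "integrable M (\<lambda>\<omega>. (S \<omega>)\<^sup>2)"
    unfolding S2_eq using prod by auto
  have "expectation (\<lambda>\<omega>. (S \<omega>)\<^sup>2) = (\<Sum>i\<in>I. \<Sum>j\<in>I. \<mu>\<^sup>2 + (if i = j then s - \<mu>\<^sup>2 else 0))"
    unfolding S2_eq using prod by (simp add: Bochner_Integration.integral_sum)
  also have "\<dots> = n\<^sup>2 * \<mu>\<^sup>2 + n * (s - \<mu>\<^sup>2)"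
    using I by (simp add: sum.distrib n_def power2_eq_square algebra_simps)
  finally have ES2: "expectation (\<lambda>\<omega>. (S \<omega>)\<^sup>2) = n\<^sup>2 * \<mu>\<^sup>2 + n * (s - \<mu>\<^sup>2)" .
  have "(1 / n * S \<omega> - \<theta>)\<^sup>2 = (1 / n)\<^sup>2 * (S \<omega>)\<^sup>2 - 2 * \<theta> / n * S \<omega> + \<theta>\<^sup>2" for \<omega>
    by (simp add: power2_eq_square algebra_simps)
  then have "expectation (\<lambda>\<omega>. (1 / n * S \<omega> - \<theta>)\<^sup>2)
      = (1 / n)\<^sup>2 * (n\<^sup>2 * \<mu>\<^sup>2 + n * (s - \<mu>\<^sup>2)) - 2 * \<theta> / n * (n * \<mu>) + \<theta>\<^sup>2"
    using S S2 ES ES2 by (simp add: prob_space)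
  also have "\<dots> = (s - \<mu>\<^sup>2) / n + (\<mu> - \<theta>)\<^sup>2"
    using n by (simp add: field_simps power2_eq_square)
  finally show ?thesis by (simp add: S_def n_def)
qed

section \<open>The normalising constant of the squared summand\<close>

text \<open>Since \<open>pochhammer (1/2) m / m!\<close> is the central binomial probability \<open>(2m choose m) / 4\<^sup>m\<close>, this is the
  Wallis asymptotics. It follows from Euler's limit formula for \<open>\<Gamma>(1/2) = \<surd>\<pi>\<close>.\<close>

lemma pochhammer_half_over_fact_asymp:
  "(\<lambda>m. sqrt (real m) * pochhammer (1 / 2) m / fact m) \<longlonglongrightarrow> 1 / sqrt pi"
proof -
  have lim: "Gamma_series (1 / 2 :: real) \<longlonglongrightarrow> sqrt pi"
    using Gamma_series_LIMSEQ[of "1 / 2 :: real"] by (simp add: Gamma_one_half_real)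
  have "(\<lambda>m. real m / (real m + 1 / 2) * (1 / Gamma_series (1 / 2) m)) \<longlonglongrightarrow> 1 * (1 / sqrt pi)"
    by (rule tendsto_mult[OF _ tendsto_divide[OF tendsto_const lim]]) (real_asymp, simp)
  moreover have "\<forall>\<^sub>F m in sequentially. real m / (real m + 1 / 2) * (1 / Gamma_series (1 / 2) m)
      = sqrt (real m) * pochhammer (1 / 2) m / fact m"
    using eventually_gt_at_top[of "0 :: nat"]
  proof eventually_elim
    case (elim m)
    have "exp (1 / 2 * of_real (ln (of_nat m))) = sqrt (real m)"
      using elim by (simp add: powr_half_sqrt[symmetric] powr_def)
    then have "Gamma_series (1 / 2) m
        = fact m * sqrt (real m) / (pochhammer (1 / 2) m * (1 / 2 + real m))"
      unfolding Gamma_series_def by (simp add: pochhammer_Suc)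
    moreover have "real m + 1 / 2 > 0" by simp
    ultimately have "real m / (real m + 1 / 2) * (1 / Gamma_series (1 / 2) m)
        = (real m / sqrt (real m)) * pochhammer (1 / 2) m / fact m"
      by (simp add: add.commute)
    then show ?case by (simp only: real_div_sqrt of_nat_0_le_iff)
  qed
  ultimately show ?thesis by (simp add: tendsto_cong)
qed

text \<open>The duplication \<open>(2m)! = 4\<^sup>m (pochhammer (1/2) m) m!\<close> turns the quotient of factorials into
  \<open>pochhammer (1/2) m / m!\<close> times a rational function of \<open>m\<close>.\<close>

lemma squared_kernel_constant_asymp:
  assumes "x > 0"
  shows "(\<lambda>m. W * ((real m + 2) / x)\<^sup>2 * fact (2 * m + 1) / (2 ^ (2 * m + 2) * (fact (m + 1))\<^sup>2)
            / sqrt (real m + 2)) \<longlonglongrightarrow> W / (2 * sqrt pi * x\<^sup>2)"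
proof -
  \<comment> \<open>\<open>q\<close> is what remains after the factor governed by Wallis has been split off.\<close>
  define q where "q m = (real m + 2)\<^sup>2 * (2 * real m + 1)
      / (4 * (real m + 1)\<^sup>2 * sqrt (real m) * sqrt (real m + 2))" for m
  have "q \<longlonglongrightarrow> 1 / 2" unfolding q_def by real_asymp
  then have "(\<lambda>m. W / x\<^sup>2 * (q m * (sqrt (real m) * pochhammer (1 / 2) m / fact m)))
      \<longlonglongrightarrow> W / x\<^sup>2 * (1 / 2 * (1 / sqrt pi))"
    by (intro tendsto_intros pochhammer_half_over_fact_asymp)
  moreover have "\<forall>\<^sub>F m in sequentially. W / x\<^sup>2 * (q m * (sqrt (real m) * pochhammer (1 / 2) m / fact m))
      = W * ((real m + 2) / x)\<^sup>2 * fact (2 * m + 1) / (2 ^ (2 * m + 2) * (fact (m + 1))\<^sup>2)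
            / sqrt (real m + 2)"
    using eventually_gt_at_top[of "0 :: nat"]
  proof eventually_elim
    case (elim m)
    define P Q s r :: real where "P = pochhammer (1 / 2) m" and "Q = fact m"
      and "s = sqrt (real m)" and "r = sqrt (real m + 2)"
    have pos: "s > 0" "r > 0" "Q > 0" "real m + 1 > 0" using elim by (auto simp: s_def r_def Q_def)
    have "fact (2 * m + 1) = (2 * real m + 1) * (2 ^ (2 * m) * P * Q)"
      using fact_double[of m, where 'a = real] by (simp add: P_def Q_def)
    moreover have "fact (m + 1) = (real m + 1) * Q" by (simp add: Q_def add.commute)
    moreover have "(2 :: real) ^ (2 * m + 2) = 4 * 2 ^ (2 * m)" by simp
    moreover have "W / x\<^sup>2 * (c\<^sup>2 * d / (4 * e\<^sup>2 * s * r) * (s * P / Q))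
        = W * (c / x)\<^sup>2 * (d * (z * P * Q)) / (4 * z * (e * Q)\<^sup>2) / r"
      if "z > 0" "e > 0" for c d e z :: real
      using that pos assms by (simp add: field_simps power2_eq_square)
    ultimately show ?case
      unfolding q_def P_def[symmetric] Q_def[symmetric] s_def[symmetric] r_def[symmetric]
      using pos by (simp only:) simp
  qed
  ultimately show ?thesis by (simp add: tendsto_cong field_simps)
qed

section \<open>The summands under the length-biased density\<close>

definition gamma_summand :: "real \<Rightarrow> real \<Rightarrow> nat \<Rightarrow> real \<Rightarrow> real" where
  "gamma_summand W x a y = W / y\<^sup>2 * (1 / Gamma (real a)) * (real a * y / x) ^ a
     * exp (- (real a / x) * y)"

lemma gamma_estimator_eq_sample_mean:
  "gamma_estimator W x n a Y \<omega> = 1 / real n * (\<Sum>i=1..n. gamma_summand W x a (Y i \<omega>))"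
  by (simp add: gamma_estimator_def gamma_summand_def)

lemma borel_measurable_gamma_summand [measurable]: "gamma_summand W x a \<in> borel_measurable borel"
  unfolding gamma_summand_def by measurable

text \<open>The point \<open>y = 0\<close> has to be excluded: there the left side is zero, while the exponential density
  that arises for \<open>k = 0\<close> is positive at the origin.\<close>

lemma length_biased_times_gamma_summand:
  assumes "W \<noteq> 0" "x > 0" "y \<noteq> 0"
  shows "length_biased_density f W y * gamma_summand W x (Suc k) y
    = erlang_density k ((real k + 1) / x) y * f y"
proof (cases "y > 0")
  case True
  have "Gamma (real (Suc k)) = fact k"
    using Gamma_fact[of k, where 'a = real] by (simp add: add.commute)
  then show ?thesis
    using True assms unfolding length_biased_density_def gamma_summand_def erlang_density_def
    by (simp add: power_divide power_mult_distrib)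
       (simp add: field_simps power2_eq_square)
next
  case False
  then show ?thesis using assms by (simp add: length_biased_density_def erlang_density_def)
qed

text \<open>Squaring doubles the rate and nearly doubles the shape, and the factor \<open>y / y\<^sup>4\<close> lowers the power of
  \<open>y\<close> to \<open>2 a - 3\<close>. With \<open>a = m + 2\<close> this is the exponent \<open>2 m + 1\<close>; for \<open>a = 1\<close> it would be negative
  and the second moment could be infinite.\<close>

lemma length_biased_times_gamma_summand_squared:
  assumes "W \<noteq> 0" "x > 0" "y \<noteq> 0"
  shows "length_biased_density f W y * (gamma_summand W x (m + 2) y)\<^sup>2
    = W * ((real m + 2) / x)\<^sup>2 * fact (2 * m + 1) / (2 ^ (2 * m + 2) * (fact (m + 1))\<^sup>2)
      * (erlang_density (2 * m + 1) (2 * (real m + 2) / x) y * f y)"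
proof (cases "y > 0")
  case True
  define b where "b = (real m + 2) / x"
  define e where "e = exp (- b * y)"
  have G: "Gamma (real (m + 2)) = fact (m + 1)"
    using Gamma_fact[of "m + 1", where 'a = real] by (simp add: add.commute)
  have "gamma_summand W x (m + 2) y = W / y\<^sup>2 * (1 / fact (m + 1)) * (b * y) ^ (m + 2) * e"
    unfolding gamma_summand_def G b_def e_def by (simp add: add.commute)
  moreover have "erlang_density (2 * m + 1) (2 * (real m + 2) / x) y
      = (2 * b) ^ (2 * m + 2) * y ^ (2 * m + 1) * e\<^sup>2 / fact (2 * m + 1)"
  proof -
    have "e\<^sup>2 = exp (- (2 * b) * y)"
      unfolding e_def power2_eq_square exp_add[symmetric] by simp
    then show ?thesis using True by (simp add: erlang_density_def b_def)
  qed
  moreover have "length_biased_density f W y = 1 / W * (y * f y)"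
    using True by (simp add: length_biased_density_def)
  moreover have "((b * y) ^ (m + 2))\<^sup>2 = b\<^sup>2 * b ^ (2 * m + 2) * (y ^ (2 * m + 1) * y ^ 3)"
    by (simp add: power_mult_distrib power_mult[symmetric] power_add[symmetric] mult.commute)
       (simp add: numeral_eq_Suc algebra_simps)
  moreover have "(2 * b) ^ (2 * m + 2) = 2 ^ (2 * m + 2) * b ^ (2 * m + 2)"
    by (rule power_mult_distrib)
  moreover have "(fact (2 * m + 1) :: real) > 0" "(fact (m + 1) :: real) > 0"
    "(2 :: real) ^ (2 * m + 2) > 0" by (simp_all del: fact_Suc)
  ultimately show ?thesis
    using True assms unfolding b_def[symmetric]
    by (simp only: power_mult_distrib[of _ _ 2] power_divide)
       (simp add: divide_simps power2_eq_square power3_eq_cube del: fact_Suc power_Suc)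
next
  case False
  then show ?thesis using assms by (simp add: length_biased_density_def erlang_density_def)
qed

section \<open>Balancing variance against squared bias\<close>

text \<open>Here \<open>s a / n\<close> behaves like \<open>V \<surd>a / n\<close> and the squared bias like \<open>B\<^sup>2 / a\<^sup>2\<close>. Both are of order
  \<open>n\<^bsup>-4/5\<^esup>\<close> when \<open>a\<close> is of order \<open>n\<^bsup>2/5\<^esup>\<close>, and \<open>\<mu>\<^sup>2 / n\<close> is of lower order because \<open>\<mu>\<close> converges.\<close>

lemma mse_rate_balance:
  fixes \<alpha> :: "nat \<Rightarrow> nat" and s \<mu> :: "nat \<Rightarrow> real"
  assumes \<alpha>: "(\<lambda>n. real (\<alpha> n)) \<sim>[sequentially] (\<lambda>n. real n powr (2/5))"
    and bias: "(\<lambda>a. real a * (\<mu> a - \<theta>)) \<longlonglongrightarrow> B"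
    and second: "(\<lambda>a. s a / sqrt (real a)) \<longlonglongrightarrow> V"
  shows "(\<lambda>n. real n powr (4/5) * ((s (\<alpha> n) - (\<mu> (\<alpha> n))\<^sup>2) / real n + (\<mu> (\<alpha> n) - \<theta>)\<^sup>2))
    \<longlonglongrightarrow> V + B\<^sup>2"
proof -
  define q where "q n = real (\<alpha> n) / real n powr (2/5)" for n
  have q: "q \<longlonglongrightarrow> 1"
    unfolding q_def by (rule asymp_equivD_strong[OF \<alpha>])
       (use eventually_gt_at_top[of "0 :: nat"] in eventually_elim, simp)
  have inf: "filterlim \<alpha> at_top sequentially"
  proof -
    have "filterlim (\<lambda>n. real n powr (2/5)) at_top sequentially" by real_asymp
    then have "filterlim (\<lambda>n. real (\<alpha> n)) at_top sequentially"
      using asymp_equiv_at_top_transfer[OF asymp_equiv_symI[OF \<alpha>]] by blast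
    then show ?thesis by (simp add: filterlim_sequentially_iff_filterlim_real)
  qed
  have \<mu>: "\<mu> \<longlonglongrightarrow> \<theta>"
  proof -
    have "(\<lambda>a. real a * (\<mu> a - \<theta>) * (1 / real a)) \<longlonglongrightarrow> B * 0"
      by (rule tendsto_mult[OF bias]) real_asymp
    moreover have "\<forall>\<^sub>F a in sequentially. real a * (\<mu> a - \<theta>) * (1 / real a) = \<mu> a - \<theta>"
      using eventually_gt_at_top[of "0 :: nat"] by eventually_elim simp
    ultimately have "(\<lambda>a. \<mu> a - \<theta>) \<longlonglongrightarrow> 0" by (simp add: tendsto_cong)
    then show ?thesis by (rule LIM_zero_cancel)
  qed
  have "(\<lambda>n. s (\<alpha> n) / sqrt (real (\<alpha> n)) * sqrt (q n) - real n powr (-1/5) * (\<mu> (\<alpha> n))\<^sup>2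
      + (real (\<alpha> n) * (\<mu> (\<alpha> n) - \<theta>) / q n)\<^sup>2) \<longlonglongrightarrow> V * sqrt 1 - 0 * \<theta>\<^sup>2 + (B / 1)\<^sup>2"
  proof (intro tendsto_intros q filterlim_compose[OF second inf] filterlim_compose[OF \<mu> inf]
      filterlim_compose[OF bias inf])
    show "(\<lambda>n. real n powr (-1/5)) \<longlonglongrightarrow> 0" by real_asymp
  qed simp
  moreover have "\<forall>\<^sub>F n in sequentially.
      s (\<alpha> n) / sqrt (real (\<alpha> n)) * sqrt (q n) - real n powr (-1/5) * (\<mu> (\<alpha> n))\<^sup>2
        + (real (\<alpha> n) * (\<mu> (\<alpha> n) - \<theta>) / q n)\<^sup>2
      = real n powr (4/5) * ((s (\<alpha> n) - (\<mu> (\<alpha> n))\<^sup>2) / real n + (\<mu> (\<alpha> n) - \<theta>)\<^sup>2)"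
    using eventually_gt_at_top[of "0 :: nat"] eventually_compose_filterlim[OF eventually_gt_at_top[of "0 :: nat"] inf]
  proof eventually_elim
    case (elim n)
    \<comment> \<open>In terms of the fifth root of \<open>n\<close> the identity is rational apart from \<open>\<surd>\<alpha>\<close>.\<close>
    define p where "p = real n powr (1/5)"
    have p: "p > 0" using elim by (simp add: p_def)
    have pw: "real n powr (real i / 5) = p ^ i" for i
      using elim by (simp add: p_def powr_powr[symmetric] powr_realpow[symmetric] powr_powr)
    have powers: "real n powr (2/5) = p ^ 2" "real n powr (4/5) = p ^ 4" "real n = p ^ 5"
      "real n powr (-1/5) = 1 / p"
      using pw[of 2] pw[of 4] pw[of 5] elim by (simp_all add: p_def powr_minus_divide)
    have "sqrt (q n) = sqrt (real (\<alpha> n)) / p"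
      unfolding q_def powers(1) using p by (simp add: real_sqrt_divide)
    moreover have "sqrt (real (\<alpha> n)) > 0" "real (\<alpha> n) > 0" using elim by auto
    ultimately show ?case
      using p unfolding q_def powers(1,2,4) unfolding powers(3)
      by (simp add: divide_simps) (simp add: algebra_simps eval_nat_numeral)
  qed
  ultimately show ?thesis by (simp add: tendsto_cong)
qed

section \<open>Bias and mean squared error of the Gamma kernel estimator\<close>

theorem theorem3p1:
  fixes f f' f'' :: "real \<Rightarrow> real" and W x :: real
    and M :: "'a measure" and Y :: "nat \<Rightarrow> 'a \<Rightarrow> real"
  assumes f_nonneg: "\<And>t. t \<ge> 0 \<Longrightarrow> f t \<ge> 0"
    and f_integrable: "set_integrable lborel {0..} f"
    and f_integral: "(LBINT t:{0..}. f t) = 1"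
    and W_finite: "set_integrable lborel {0..} (\<lambda>t. t * f t)"
    and W_eq: "W = (LBINT t:{0..}. t * f t)"
    and W_pos: "W > 0"
    and deriv1: "\<And>t. t \<ge> 0 \<Longrightarrow> (f has_real_derivative f' t) (at t within {0..})"
    and deriv2: "\<And>t. t \<ge> 0 \<Longrightarrow> (f' has_real_derivative f'' t) (at t within {0..})"
    and deriv2_cont: "continuous_on {0..} f''"
    and deriv2_bdd: "bdd_above ((\<lambda>t. \<bar>f'' t\<bar>) ` {0..})"
    and prob: "prob_space M"
    and indep: "prob_space.indep_vars M (\<lambda>_. borel) Y {1..}"
    and distr: "\<And>i. i \<ge> 1 \<Longrightarrow>
      distributed M lborel (Y i) (\<lambda>y. ennreal (length_biased_density f W y))"
    and x_pos: "x > 0" and fx_pos: "f x > 0"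
  shows "(\<exists>r \<in> o(\<lambda>\<alpha>. 1 / real \<alpha>). \<forall>n\<ge>1. \<forall>\<alpha>\<ge>1.
            (\<integral>\<omega>. gamma_estimator W x n \<alpha> Y \<omega> \<partial>M) - f x
              = x\<^sup>2 * f'' x / (2 * real \<alpha>) + r \<alpha>)
       \<and> (\<forall>\<alpha> :: nat \<Rightarrow> nat.
            (\<forall>n\<ge>1. \<alpha> n \<ge> 1) \<longrightarrow>
            (\<lambda>n. real (\<alpha> n)) \<sim>[sequentially] (\<lambda>n. real n powr (2/5)) \<longrightarrow>
            (\<lambda>n. MSE M (gamma_estimator W x n (\<alpha> n) Y) (f x)
                 - real n powr (-4/5) * (W * f x / (2 * sqrt pi * x\<^sup>2) + x ^ 4 * (f'' x)\<^sup>2 / 4))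
              \<in> o(\<lambda>n. real n powr (-4/5)))"
proof -
  interpret prob_space M by (rule prob)
  obtain K where K: "\<And>t. t \<ge> 0 \<Longrightarrow> \<bar>f'' t\<bar> \<le> K"
    using deriv2_bdd unfolding bdd_above_def by auto
  interpret bounded_second_derivative f f' f'' K
    by standard (fact deriv1 deriv2 K)+
  define \<mu> where "\<mu> a = (\<integral>y. length_biased_density f W y * gamma_summand W x a y \<partial>lborel)" for a
  define s where "s a = (\<integral>y. length_biased_density f W y * (gamma_summand W x a y)\<^sup>2 \<partial>lborel)" for a
  define c where "c m = W * ((real m + 2) / x)\<^sup>2 * fact (2 * m + 1)
      / (2 ^ (2 * m + 2) * (fact (m + 1))\<^sup>2)" for m
  have dens_nonneg: "0 \<le> length_biased_density f W y" for y
    using f_nonneg W_pos by (auto simp: length_biased_density_def indicator_def)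
  have dens_measurable [measurable]: "length_biased_density f W \<in> borel_measurable borel"
    using distributed_real_measurable[OF dens_nonneg distr[of 1]] by simp
  have AE_ne: "AE y :: real in lborel. y \<noteq> 0" by (rule AE_lborel_singleton)

  have first: "has_bochner_integral lborel
      (\<lambda>y. length_biased_density f W y * gamma_summand W x (Suc k) y)
      (\<integral>t. erlang_density k ((real k + 1) / x) t * f t \<partial>lborel)" for k
  proof -
    have "integrable lborel (\<lambda>t. erlang_density k ((real k + 1) / x) t * f t)"
      by (rule integrable_erlang) (use x_pos in simp)
    moreover have "AE y in lborel. erlang_density k ((real k + 1) / x) y * f y
        = length_biased_density f W y * gamma_summand W x (Suc k) y"
      using AE_ne by eventually_elim
        (use length_biased_times_gamma_summand W_pos x_pos in simp)
    ultimately show ?thesis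
      by (subst has_bochner_integral_cong_AE[symmetric])
         (auto intro: has_bochner_integral_integrable)
  qed
  have second: "has_bochner_integral lborel
      (\<lambda>y. length_biased_density f W y * (gamma_summand W x (m + 2) y)\<^sup>2)
      (c m * (\<integral>t. erlang_density (2 * m + 1) (2 * (real m + 2) / x) t * f t \<partial>lborel))" for m
  proof -
    have "has_bochner_integral lborel
        (\<lambda>t. c m * (erlang_density (2 * m + 1) (2 * (real m + 2) / x) t * f t))
        (c m * (\<integral>t. erlang_density (2 * m + 1) (2 * (real m + 2) / x) t * f t \<partial>lborel))"
      by (intro has_bochner_integral_mult_right has_bochner_integral_integrable integrable_erlang)
         (use x_pos in simp)
    moreover have "AE y in lborel.
        c m * (erlang_density (2 * m + 1) (2 * (real m + 2) / x) y * f y)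
        = length_biased_density f W y * (gamma_summand W x (m + 2) y)\<^sup>2"
      using AE_ne
    proof eventually_elim
      case (elim y)
      show ?case unfolding c_def
        by (rule length_biased_times_gamma_summand_squared[symmetric]) (use elim W_pos x_pos in auto)
    qed
    ultimately show ?thesis
      by (subst has_bochner_integral_cong_AE[symmetric])
         (auto simp: has_bochner_integral_iff)
  qed
  have \<mu>_eq: "\<mu> (Suc k) = (\<integral>t. erlang_density k ((real k + 1) / x) t * f t \<partial>lborel)" for k
    using first[of k] by (simp add: \<mu>_def has_bochner_integral_iff)
  have s_eq: "s (m + 2)
      = c m * (\<integral>t. erlang_density (2 * m + 1) (2 * (real m + 2) / x) t * f t \<partial>lborel)" for m
    using second[of m] by (simp only: s_def has_bochner_integral_iff)

  have bias: "(\<lambda>a. real a * (\<mu> a - f x)) \<longlonglongrightarrow> x\<^sup>2 * f'' x / 2"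
  proof (rule LIMSEQ_imp_Suc)
    show "(\<lambda>k. real (Suc k) * (\<mu> (Suc k) - f x)) \<longlonglongrightarrow> x\<^sup>2 * f'' x / 2"
      using erlang_bias_asymp[OF deriv2_cont x_pos] unfolding \<mu>_eq by (simp add: add.commute)
  qed
  have second_moment: "(\<lambda>a. s a / sqrt (real a)) \<longlonglongrightarrow> W * f x / (2 * sqrt pi * x\<^sup>2)"
  proof (rule LIMSEQ_offset[where k = 2])
    have "(\<lambda>m. \<integral>t. erlang_density (2 * m + 1) (2 * (real m + 2) / x) t * f t \<partial>lborel) \<longlonglongrightarrow> f x"
    proof (rule erlang_mean_tendsto)
      show "(\<lambda>m. (real (2 * m + 1) + 1) / (2 * (real m + 2) / x)) \<longlonglongrightarrow> x"
        "(\<lambda>m. (real (2 * m + 1) + 1) / (2 * (real m + 2) / x)\<^sup>2) \<longlonglongrightarrow> 0"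
        using x_pos by real_asymp+
    qed (use x_pos in auto)
    then have "(\<lambda>m. c m / sqrt (real m + 2) *
        (\<integral>t. erlang_density (2 * m + 1) (2 * (real m + 2) / x) t * f t \<partial>lborel))
        \<longlonglongrightarrow> W / (2 * sqrt pi * x\<^sup>2) * f x"
      unfolding c_def by (intro tendsto_mult squared_kernel_constant_asymp x_pos)
    then show "(\<lambda>m. s (m + 2) / sqrt (real (m + 2))) \<longlonglongrightarrow> W * f x / (2 * sqrt pi * x\<^sup>2)"
      unfolding s_eq of_nat_add of_nat_numeral by simp
  qed

  have Y_int: "integrable M (\<lambda>\<omega>. gamma_summand W x (Suc k) (Y i \<omega>))"
    and Y_mean: "expectation (\<lambda>\<omega>. gamma_summand W x (Suc k) (Y i \<omega>)) = \<mu> (Suc k)" if "i \<ge> 1" for i k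
    using distributed_integrable[OF distr[OF that], of "gamma_summand W x (Suc k)"]
      distributed_integral[OF distr[OF that], of "gamma_summand W x (Suc k)"] first[of k]
    by (simp_all add: dens_nonneg \<mu>_def has_bochner_integral_iff)
  have Y_int2: "integrable M (\<lambda>\<omega>. (gamma_summand W x (m + 2) (Y i \<omega>))\<^sup>2)"
    and Y_second: "expectation (\<lambda>\<omega>. (gamma_summand W x (m + 2) (Y i \<omega>))\<^sup>2) = s (m + 2)"
    if "i \<ge> 1" for i m
    using distributed_integrable[OF distr[OF that], of "\<lambda>y. (gamma_summand W x (m + 2) y)\<^sup>2"]
      distributed_integral[OF distr[OF that], of "\<lambda>y. (gamma_summand W x (m + 2) y)\<^sup>2"] second[of m]
    by (simp_all add: dens_nonneg s_def has_bochner_integral_iff del: add_2_eq_Suc')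

  have mean: "(\<integral>\<omega>. gamma_estimator W x n a Y \<omega> \<partial>M) = \<mu> a" if n: "n \<ge> 1" and a: "a \<ge> 1" for n a
  proof -
    obtain k where k: "a = Suc k" using a by (cases a) auto
    have "(\<integral>\<omega>. gamma_estimator W x n a Y \<omega> \<partial>M) = 1 / real n * (\<Sum>i=1..n. \<mu> a)"
      unfolding gamma_estimator_eq_sample_mean k using Y_int Y_mean
      by (subst integral_mult_right_zero, subst Bochner_Integration.integral_sum) auto
    then show ?thesis using n by simp
  qed
  \<comment> \<open>For \<open>a \<ge> 2\<close> the summands are square integrable; \<open>\<alpha> n\<close> exceeds this eventually.\<close>
  have mse: "MSE M (gamma_estimator W x n a Y) (f x)
      = (s a - (\<mu> a)\<^sup>2) / real n + (\<mu> a - f x)\<^sup>2" if n: "n \<ge> 1" and a: "a \<ge> 2" for n a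
  proof -
    obtain m where m: "a = m + 2" using a by (metis add.commute le_Suc_ex)
    have "indep_vars (\<lambda>_. borel) Y {1..n}"
      by (rule indep_vars_subset[OF indep]) auto
    then have "indep_vars (\<lambda>_. borel) (\<lambda>i \<omega>. gamma_summand W x a (Y i \<omega>)) {1..n}"
      by (rule indep_vars_compose2) auto
    then have "expectation (\<lambda>\<omega>. (1 / real (card {1..n}) * (\<Sum>i=1..n. gamma_summand W x a (Y i \<omega>)) - f x)\<^sup>2)
        = (s a - (\<mu> a)\<^sup>2) / real (card {1..n}) + (\<mu> a - f x)\<^sup>2"
    proof (intro mean_square_error_of_sample_mean)
      fix i assume i: "i \<in> {1..n}"
      show "integrable M (\<lambda>\<omega>. gamma_summand W x a (Y i \<omega>))"
        "expectation (\<lambda>\<omega>. gamma_summand W x a (Y i \<omega>)) = \<mu> a"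
        using Y_int[of i "Suc m"] Y_mean[of i "Suc m"] i m by auto
      show "integrable M (\<lambda>\<omega>. (gamma_summand W x a (Y i \<omega>))\<^sup>2)"
        "expectation (\<lambda>\<omega>. (gamma_summand W x a (Y i \<omega>))\<^sup>2) = s a"
        using Y_int2[of i m] Y_second[of i m] i unfolding m by auto
    qed (use n in auto)
    then show ?thesis by (simp add: MSE_def gamma_estimator_eq_sample_mean)
  qed

  show ?thesis
  proof (intro conjI allI impI)
    define r where "r a = \<mu> a - f x - x\<^sup>2 * f'' x / (2 * real a)" for a
    have "(\<lambda>a. real a * (\<mu> a - f x) - x\<^sup>2 * f'' x / 2) \<longlonglongrightarrow> x\<^sup>2 * f'' x / 2 - x\<^sup>2 * f'' x / 2"
      by (intro tendsto_intros bias)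
    moreover have "\<forall>\<^sub>F a in sequentially.
        real a * (\<mu> a - f x) - x\<^sup>2 * f'' x / 2 = r a / (1 / real a)"
      using eventually_gt_at_top[of "0 :: nat"]
      by eventually_elim (simp add: r_def field_simps)
    ultimately have "(\<lambda>a. r a / (1 / real a)) \<longlonglongrightarrow> 0" by (simp add: tendsto_cong)
    moreover have "\<forall>\<^sub>F a in sequentially. 1 / real a \<noteq> 0"
      using eventually_gt_at_top[of "0 :: nat"] by eventually_elim simp
    ultimately have "r \<in> o(\<lambda>a. 1 / real a)" by (intro smalloI_tendsto) auto
    then show "\<exists>r \<in> o(\<lambda>\<alpha>. 1 / real \<alpha>). \<forall>n\<ge>1. \<forall>\<alpha>\<ge>1.
        (\<integral>\<omega>. gamma_estimator W x n \<alpha> Y \<omega> \<partial>M) - f x = x\<^sup>2 * f'' x / (2 * real \<alpha>) + r \<alpha>"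
      using mean by (intro bexI[of _ r]) (auto simp: r_def)
  next
    fix \<alpha> :: "nat \<Rightarrow> nat"
    assume \<alpha>: "(\<lambda>n. real (\<alpha> n)) \<sim>[sequentially] (\<lambda>n. real n powr (2/5))"
    define L where "L = W * f x / (2 * sqrt pi * x\<^sup>2) + x ^ 4 * (f'' x)\<^sup>2 / 4"
    define err where "err n = MSE M (gamma_estimator W x n (\<alpha> n) Y) (f x)" for n
    have L_eq: "W * f x / (2 * sqrt pi * x\<^sup>2) + (x\<^sup>2 * f'' x / 2)\<^sup>2 = L"
      by (simp add: L_def power_divide power_mult_distrib)
    have "filterlim (\<lambda>n. real n powr (2/5)) at_top sequentially" by real_asymp
    then have "filterlim (\<lambda>n. real (\<alpha> n)) at_top sequentially"
      using asymp_equiv_at_top_transfer[OF asymp_equiv_symI[OF \<alpha>]] by blast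
    then have large: "\<forall>\<^sub>F n in sequentially. real (\<alpha> n) \<ge> 2"
      unfolding filterlim_at_top by blast
    have "(\<lambda>n. real n powr (4/5) * ((s (\<alpha> n) - (\<mu> (\<alpha> n))\<^sup>2) / real n + (\<mu> (\<alpha> n) - f x)\<^sup>2) - L)
        \<longlonglongrightarrow> L - L"
      using mse_rate_balance[OF \<alpha> bias second_moment] unfolding L_eq
      by (intro tendsto_diff tendsto_const)
    moreover have "\<forall>\<^sub>F n in sequentially.
        real n powr (4/5) * ((s (\<alpha> n) - (\<mu> (\<alpha> n))\<^sup>2) / real n + (\<mu> (\<alpha> n) - f x)\<^sup>2) - L
        = (err n - real n powr (-4/5) * L) / real n powr (-4/5)"
      using large eventually_gt_at_top[of "0 :: nat"]
    proof eventually_elim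
      case (elim n)
      have "real n powr (-4/5) = 1 / real n powr (4/5)"
        using powr_minus_divide[of "real n" "4/5"] by simp
      moreover have "real n powr (4/5) > 0" using elim by simp
      moreover have "err n = (s (\<alpha> n) - (\<mu> (\<alpha> n))\<^sup>2) / real n + (\<mu> (\<alpha> n) - f x)\<^sup>2"
        unfolding err_def using elim by (intro mse) auto
      ultimately show ?case by (simp add: algebra_simps)
    qed
    ultimately have "(\<lambda>n. (err n - real n powr (-4/5) * L) / real n powr (-4/5)) \<longlonglongrightarrow> 0"
      by (simp add: tendsto_cong)
    moreover have "\<forall>\<^sub>F n in sequentially. real n powr (-4/5) \<noteq> 0"
      using eventually_gt_at_top[of "0 :: nat"] by eventually_elim simp
    ultimately have "(\<lambda>n. err n - real n powr (-4/5) * L) \<in> o(\<lambda>n. real n powr (-4/5))"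
      by (intro smalloI_tendsto)
    then show "(\<lambda>n. MSE M (gamma_estimator W x n (\<alpha> n) Y) (f x)
        - real n powr (-4/5) * (W * f x / (2 * sqrt pi * x\<^sup>2) + x ^ 4 * (f'' x)\<^sup>2 / 4))
        \<in> o(\<lambda>n. real n powr (-4/5))"
      by (simp only: err_def L_def)
  qed
qed

end
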